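(* Let $f:\mathbb{R}^n\to\mathbb{R}$ be a $\mathcal{C}^1$-smooth function whose gradient is locally Lipschitz continuous on $\mathbb{R}^n$. Let $\{x^k\}$ be the sequence generated by Algorithm DFB (described in the context) and assume that $\nabla f(x^k)\ne 0$ for all $k\in\mathbb{N}$. Then either $f(x^k)\to-\infty$ as $k\to\infty$, or the following assertions hold: (i) Every accumulation point of $\{x^k\}$ is a stationary point of $f$. (ii) If the sequence $\{x^k\}$ is bounded, then the set of accumulation points of $\{x^k\}$ is nonempty, compact, and connected in $\mathbb{R}^n$. (iii) If $\{x^k\}$ has an isolated accumulation point, then this sequence converges to it.
   Context: $\|\cdot\|$ is the Euclidean norm on $\mathbb{R}^n$ and $\mathbb{N}=\{1,2,\dots\}$. A stationary point of $f$ is a point $x$ with $\nabla f(x)=0$. Local Lipschitz continuity of $\nabla f$ on $\mathbb{R}^n$ means Lipschitz continuity on every compact subset of $\mathbb{R}^n$. Local approximation: a mapping $\mathcal{G}:\mathbb{R}^n\times(0,\infty)\to\mathbb{R}^n$ is a local approximation of $\nabla f$ if for any bounded set $\Omega\subset\mathbb{R}^n$ and any $\Delta>0$ there is $C>0$ such that $\|\mathcal{G}(x,\delta)-\nabla f(x)\|\le C\delta$ for all $(x,\delta)\in\Omega\times(0,\Delta]$. Algorithm DFB. Step 0: Choose a local approximation $\mathcal{G}$ of $\nabla f$, an initial point $x^1\in\mathbb{R}^n$, an initial radius $\delta_1>0$, a constant $C_1>0$, factors $\theta\in(0,1)$, $\mu>2$, $\eta>1$, linesearch constants $\beta\in(0,1/2)$,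 $\gamma\in(0,1)$, $\bar\tau>0$, an initial bound $t_1^{\min}\in(0,\bar\tau)$, and a sequence $\{\nu_k\}\subset(0,\infty)$ with $\nu_k\downarrow0$ as $k\to\infty$. Set $k:=1$. Step 1: Select $g^k$ and the smallest nonnegative integer $i_k$ so that $g^k=\mathcal{G}(x^k,\min\{\theta^{i_k}\delta_k,\nu_k\})$ and $\|g^k\|>\mu C_k\theta^{i_k}\delta_k$ (such $g^k,i_k$ exist whenever $\nabla f(x^k)\neq0$). Set $\delta_{k+1}:=\theta^{i_k}\delta_k$. Step 2: Set $t_k:=\bar\tau$. While $f(x^k-t_kg^k)>f(x^k)-\beta t_k\|g^k\|^2$ and $t_k\ge t_k^{\min}$, set $t_k:=\gamma t_k$. Step 3: If $t_k\ge t_k^{\min}$, then set $\tau_k:=t_k$, $C_{k+1}:=C_k$, $t_{k+1}^{\min}:=t_k^{\min}$. Otherwise, set $\tau_k:=0$, $C_{k+1}:=\eta C_k$, $t_{k+1}^{\min}:=\gamma t_k^{\min}$. Step 4: Set $x^{k+1}:=x^k-\tau_kg^k$. Increase $k$ by $1$ and go back to Step 1. *)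

theory Defs
  imports "HOL-Analysis.Analysis" "HOL-Library.While_Combinator"
begin

definition gradient :: "('a::euclidean_space \<Rightarrow> real) \<Rightarrow> 'a \<Rightarrow> 'a"
  where "gradient f x = (THE D. GDERIV f x :> D)"

lemma GDERIV_gradient:
  fixes f :: "'a::euclidean_space \<Rightarrow> real"
  assumes "f differentiable at x"
  shows "GDERIV f x :> gradient f x"
proof -
  obtain f' where f': "(f has_derivative f') (at x)"
    using assms by (auto simp: differentiable_def)
  then have lin: "linear f'"
    using has_derivative_linear by blast
  have "f' h = inner h (adjoint f' 1)" for h
    using adjoint_works[OF lin, of h 1] by simp
  then have "f' = (\<lambda>h. inner h (adjoint f' 1))"
    by (rule ext)
  with f' have ex: "GDERIV f x :> adjoint f' 1"
    unfolding gderiv_def by metis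
  have uniq: "D = adjoint f' 1" if D: "GDERIV f x :> D" for D
  proof -
    have eq: "(\<lambda>h. inner h D) = (\<lambda>h. inner h (adjoint f' 1))"
      using has_derivative_unique[OF D[unfolded gderiv_def] ex[unfolded gderiv_def]] .
    show ?thesis
      using vector_eq_ldot[of D "adjoint f' 1"] fun_cong[OF eq] by blast
  qed
  show ?thesis
    unfolding gradient_def by (rule theI[where P = "\<lambda>D. GDERIV f x :> D", OF ex uniq])
qed

definition C1_smooth :: "('a::euclidean_space \<Rightarrow> real) \<Rightarrow> bool"
  where "C1_smooth f \<longleftrightarrow> (\<forall>x. f differentiable at x) \<and> continuous_on UNIV (gradient f)"

definition locally_Lipschitz :: "('a::euclidean_space \<Rightarrow> 'b::metric_space) \<Rightarrow> bool"
  where "locally_Lipschitz F \<longleftrightarrow> (\<forall>K. compact K \<longrightarrow> (\<exists>L. L-lipschitz_on K F))"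

definition stationary_point :: "('a::euclidean_space \<Rightarrow> real) \<Rightarrow> 'a \<Rightarrow> bool"
  where "stationary_point f x \<longleftrightarrow> gradient f x = 0"

definition accumulation_points :: "(nat \<Rightarrow> 'a::topological_space) \<Rightarrow> 'a set"
  where "accumulation_points x = {p. \<exists>r. strict_mono r \<and> (x \<circ> r) \<longlonglongrightarrow> p}"

(* The approximation is only meaningful at positive radii; its values at nonpositive
   radii are unconstrained and never used. *)
definition local_approximation ::
    "('a::euclidean_space \<Rightarrow> real) \<Rightarrow> ('a \<Rightarrow> real \<Rightarrow> 'a) \<Rightarrow> bool"
  where "local_approximation f G \<longleftrightarrow>
    (\<forall>\<Omega> \<Delta>. bounded \<Omega> \<and> \<Delta> > 0 \<longrightarrow>
      (\<exists>C>0. \<forall>x\<in>\<Omega>. \<forall>\<delta>\<in>{0<..\<Delta>}. norm (G x \<delta> - gradient f x) \<le> C * \<delta>))"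

(* A run of the derivative-free method with backtracking stepsize.  All sequences are indexed by k = 1, 2, ...; their values at 0 are
   unconstrained.  The inputs x^1, delta_1, C_1, t_1^min are the first terms of the
   corresponding sequences.  ls k is the value of t_k when the backtracking loop (step2) exits. *)
locale DFB =
  fixes f :: "'a::euclidean_space \<Rightarrow> real"
    and G :: "'a \<Rightarrow> real \<Rightarrow> 'a"
    and \<theta> \<mu> \<eta> \<beta> \<gamma> \<tau>max :: real
    and \<nu> :: "nat \<Rightarrow> real"
    and x g :: "nat \<Rightarrow> 'a"
    and i :: "nat \<Rightarrow> nat"
    and \<delta> C tmin ls \<tau> :: "nat \<Rightarrow> real"
  assumes approx: "local_approximation f G"
    and init: "\<delta> 1 > 0" "C 1 > 0" "0 < tmin 1" "tmin 1 < \<tau>max"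
    and factors: "0 < \<theta>" "\<theta> < 1" "\<mu> > 2" "\<eta> > 1"
    and linesearch: "0 < \<beta>" "\<beta> < 1/2" "0 < \<gamma>" "\<gamma> < 1" "\<tau>max > 0"
    and nu_pos: "\<And>k. k \<ge> 1 \<Longrightarrow> \<nu> k > 0"
    and nu_decreasing: "\<And>k. k \<ge> 1 \<Longrightarrow> \<nu> (Suc k) \<le> \<nu> k"
    and nu_tendsto: "\<nu> \<longlonglongrightarrow> 0"
    and step1_g: "\<And>k. k \<ge> 1 \<Longrightarrow> g k = G (x k) (min (\<theta> ^ i k * \<delta> k) (\<nu> k))"
    and step1_accept: "\<And>k. k \<ge> 1 \<Longrightarrow> norm (g k) > \<mu> * C k * \<theta> ^ i k * \<delta> k"
    and step1_least: "\<And>k j. k \<ge> 1 \<Longrightarrow> j < i k \<Longrightarrow>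
      \<not> norm (G (x k) (min (\<theta> ^ j * \<delta> k) (\<nu> k))) > \<mu> * C k * \<theta> ^ j * \<delta> k"
    and step1_delta: "\<And>k. k \<ge> 1 \<Longrightarrow> \<delta> (Suc k) = \<theta> ^ i k * \<delta> k"
    and step2: "\<And>k. k \<ge> 1 \<Longrightarrow>
      while_option
        (\<lambda>t. f (x k - t *\<^sub>R g k) > f (x k) - \<beta> * t * (norm (g k))\<^sup>2 \<and> t \<ge> tmin k)
        (\<lambda>t. \<gamma> * t) \<tau>max = Some (ls k)"
    and step3_success: "\<And>k. k \<ge> 1 \<Longrightarrow> ls k \<ge> tmin k \<Longrightarrow>
      \<tau> k = ls k \<and> C (Suc k) = C k \<and> tmin (Suc k) = tmin k"
    and step3_failure: "\<And>k. k \<ge> 1 \<Longrightarrow> \<not> ls k \<ge> tmin k \<Longrightarrow>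
      \<tau> k = 0 \<and> C (Suc k) = \<eta> * C k \<and> tmin (Suc k) = \<gamma> * tmin k"
    and step4: "\<And>k. k \<ge> 1 \<Longrightarrow> x (Suc k) = x k - \<tau> k *\<^sub>R g k"

end

theory Submission
  imports Defs
begin

text \<open>
  The linesearch either moves with sufficient decrease or does not move at all, so \<open>f (x k)\<close>
  never increases. If it does not tend to \<open>-\<infinity>\<close>, it converges, and then the decreases
  \<open>\<beta> * \<tau> k * (norm (g k))\<^sup>2\<close> tend to zero. Everything else follows from this one fact
  (\<open>steps_tendsto_0\<close>), used in two ways.

  Because \<open>\<tau>\<close> is bounded above, the steps \<open>\<tau> k * norm (g k)\<close> tend to zero as well. A sequence
  with vanishing steps cannot jump over the frontier of a bounded set: if it enters and leaves the
  set infinitely often, it accumulates on the frontier (\<open>accumulation_point_on_frontier\<close>). This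
  crossing principle yields both the connectedness of the set of accumulation points and the
  convergence to an isolated one.

  For stationarity it must be excluded that the products vanish merely because \<open>\<tau> k\<close> does. Near
  any given point the stepsizes are eventually bounded away from zero
  (\<open>stepsize_locally_bounded_below\<close>): if the linesearch fails only finitely often, its threshold
  is eventually constant, whereas infinitely many failures drive \<open>C\<close> to infinity and the threshold to zero,
  so that \<open>g k\<close> becomes an accurate descent direction for which backtracking stops early. Hence
  \<open>g k\<close> tends to zero along every convergent subsequence, and so does the gradient, since
  \<open>\<nu>\<close> tends to zero and bounds the approximation radius.
\<close>

section \<open>Sequences with vanishing steps\<close>

lemma accumulation_points_iff_frequently:
  fixes x :: "nat \<Rightarrow> 'a::metric_space"
  shows "p \<in> accumulation_points x \<longleftrightarrow> (\<forall>e>0. \<exists>\<^sub>F n in sequentially. dist (x n) p < e)"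
proof
  assume "p \<in> accumulation_points x"
  then obtain r where r: "strict_mono r" and lim: "(x \<circ> r) \<longlonglongrightarrow> p"
    by (auto simp: accumulation_points_def)
  show "\<forall>e>0. \<exists>\<^sub>F n in sequentially. dist (x n) p < e"
  proof (intro allI impI)
    fix e :: real assume "e > 0"
    then have "\<forall>\<^sub>F n in sequentially. dist (x (r n)) p < e"
      using tendstoD[OF lim] by simp
    then obtain N where N: "\<And>n. n \<ge> N \<Longrightarrow> dist (x (r n)) p < e"
      unfolding eventually_sequentially by blast
    show "\<exists>\<^sub>F n in sequentially. dist (x n) p < e"
      unfolding frequently_sequentially
    proof
      fix m
      have "m \<le> r (max m N)"
        using seq_suble[OF r, of "max m N"] by simp
      then show "\<exists>n\<ge>m. dist (x n) p < e"
        using N[of "max m N"] by auto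
    qed
  qed
next
  assume freq: "\<forall>e>0. \<exists>\<^sub>F n in sequentially. dist (x n) p < e"
  have "\<exists>r. \<forall>n. dist (x (r n)) p < 1 / real (Suc n) \<and> r n < r (Suc n)"
  proof (rule dependent_nat_choice)
    show "\<exists>m. dist (x m) p < 1 / real (Suc 0)"
      using freq[rule_format, of 1] by (auto simp: frequently_sequentially)
    fix m n
    have "1 / real (Suc (Suc n)) > 0" by simp
    then obtain m' where "m' \<ge> Suc m" "dist (x m') p < 1 / real (Suc (Suc n))"
      using freq unfolding frequently_sequentially by blast
    then show "\<exists>m'. dist (x m') p < 1 / real (Suc (Suc n)) \<and> m < m'"
      by (auto intro!: exI[of _ m'])
  qed
  then obtain r where r: "\<And>n. dist (x (r n)) p < 1 / real (Suc n)" "\<And>n. r n < r (Suc n)"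
    by blast
  have "(\<lambda>n. dist ((x \<circ> r) n) p) \<longlonglongrightarrow> 0"
  proof (rule Lim_null_comparison)
    show "\<forall>\<^sub>F n in sequentially. norm (dist ((x \<circ> r) n) p) \<le> 1 / real (Suc n)"
      using r(1) by (auto intro!: always_eventually less_imp_le)
    show "(\<lambda>n. 1 / real (Suc n)) \<longlonglongrightarrow> 0"
      using LIMSEQ_inverse_real_of_nat by (simp add: inverse_eq_divide)
  qed
  then have "(x \<circ> r) \<longlonglongrightarrow> p"
    using tendsto_dist_iff by blast
  moreover have "strict_mono r"
    using r(2) by (simp add: strict_mono_Suc_iff)
  ultimately show "p \<in> accumulation_points x"
    by (auto simp: accumulation_points_def)
qed

lemma closed_accumulation_points:
  fixes x :: "nat \<Rightarrow> 'a::metric_space"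
  shows "closed (accumulation_points x)"
  unfolding closed_sequential_limits
proof (intro allI impI)
  fix a l assume *: "(\<forall>n. a n \<in> accumulation_points x) \<and> a \<longlonglongrightarrow> l"
  show "l \<in> accumulation_points x"
    unfolding accumulation_points_iff_frequently
  proof (intro allI impI)
    fix e :: real assume "e > 0"
    then have "\<forall>\<^sub>F n in sequentially. dist (a n) l < e / 2"
      using * by (intro tendstoD) auto
    then obtain n where n: "dist (a n) l < e / 2"
      by (auto simp: eventually_sequentially)
    have "\<exists>\<^sub>F m in sequentially. dist (x m) (a n) < e / 2"
      using * \<open>e > 0\<close> accumulation_points_iff_frequently[of "a n" x] half_gt_zero by blast
    then show "\<exists>\<^sub>F m in sequentially. dist (x m) l < e"
    proof (rule frequently_elim1)
      fix m assume "dist (x m) (a n) < e / 2"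
      then show "dist (x m) l < e"
        using n dist_triangle[of "x m" l "a n"] by linarith
    qed
  qed
qed

lemma accumulation_points_frequently_in_open:
  fixes x :: "nat \<Rightarrow> 'a::metric_space"
  assumes "p \<in> accumulation_points x" "open U" "p \<in> U"
  shows "\<exists>\<^sub>F n in sequentially. x n \<in> U"
proof -
  obtain e where "e > 0" "ball p e \<subseteq> U"
    using assms openE by blast
  have "\<exists>\<^sub>F n in sequentially. dist (x n) p < e"
    using assms(1) \<open>e > 0\<close> accumulation_points_iff_frequently by blast
  then show ?thesis
    by (rule frequently_elim1) (use \<open>ball p e \<subseteq> U\<close> in \<open>auto simp: dist_commute\<close>)
qed

lemma accumulation_points_subset_closed:
  fixes x :: "nat \<Rightarrow> 'a::metric_space"
  assumes "closed S" "\<And>n. n \<ge> N \<Longrightarrow> x n \<in> S"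
  shows "accumulation_points x \<subseteq> S"
proof
  fix p assume p: "p \<in> accumulation_points x"
  show "p \<in> S"
  proof (rule ccontr)
    assume "p \<notin> S"
    then have "\<exists>\<^sub>F n in sequentially. x n \<in> - S"
      using assms(1) by (intro accumulation_points_frequently_in_open[OF p]) auto
    then obtain n where "n \<ge> N" "x n \<in> - S"
      unfolding frequently_sequentially by blast
    then show False
      using assms(2) by blast
  qed
qed

text \<open>
  A sequence that keeps entering and leaving a set \<open>U\<close> crosses its frontier again and again:
  the segment from the last point inside to the next point outside meets the frontier. When the
  steps shrink to zero, the iterates come arbitrarily close to these crossing points, and
  compactness of the frontier gives an accumulation point on it.
\<close>

lemma accumulation_point_on_frontier:
  fixes x :: "nat \<Rightarrow> 'a::euclidean_space"
  assumes steps: "(\<lambda>n. dist (x (Suc n)) (x n)) \<longlonglongrightarrow> 0"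
    and "bounded U"
    and inside: "\<exists>\<^sub>F n in sequentially. x n \<in> U"
    and outside: "\<exists>\<^sub>F n in sequentially. x n \<notin> U"
  shows "accumulation_points x \<inter> frontier U \<noteq> {}"
proof -
  have "\<exists>\<^sub>F n in sequentially. x n \<in> U \<and> x (Suc n) \<notin> U"
  proof (rule ccontr)
    assume "\<not> (\<exists>\<^sub>F n in sequentially. x n \<in> U \<and> x (Suc n) \<notin> U)"
    then obtain N where N: "\<And>n. n \<ge> N \<Longrightarrow> x n \<in> U \<Longrightarrow> x (Suc n) \<in> U"
      by (auto simp: frequently_def eventually_sequentially)
    obtain m where m: "m \<ge> N" "x m \<in> U"
      using inside by (auto simp: frequently_sequentially)
    have "x n \<in> U" if "n \<ge> m" for n
      using that by (induction n rule: dec_induct) (use m N in auto)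
    then show False
      using outside by (auto simp: frequently_sequentially)
  qed
  then have "infinite {n. x n \<in> U \<and> x (Suc n) \<notin> U}"
    by (simp add: frequently_cofinite flip: cofinite_eq_sequentially)
  from infinite_enumerate[OF this] obtain r :: "nat \<Rightarrow> nat"
    where r: "strict_mono r" and "\<And>n. r n \<in> {n. x n \<in> U \<and> x (Suc n) \<notin> U}"
    by blast
  then have crossing: "x (r n) \<in> U" "x (Suc (r n)) \<notin> U" for n
    by simp_all
  have "closed_segment (x (r n)) (x (Suc (r n))) \<inter> frontier U \<noteq> {}" for n
    using crossing[of n] by (intro connected_Int_frontier connected_segment) blast+
  then have "\<forall>n. \<exists>z. z \<in> frontier U \<and> z \<in> closed_segment (x (r n)) (x (Suc (r n)))"
    by blast
  from choice[OF this] obtain y where y: "\<And>n. y n \<in> frontier U"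
      "\<And>n. y n \<in> closed_segment (x (r n)) (x (Suc (r n)))"
    by blast
  have "compact (frontier U)"
    using \<open>bounded U\<close> compact_frontier_bounded by blast
  then obtain q s where q: "q \<in> frontier U" and s: "strict_mono s" "(y \<circ> s) \<longlonglongrightarrow> q"
    using y(1) compact_imp_seq_compact seq_compactE[of "frontier U" y] by blast
  have "(\<lambda>n. dist (y n) (x (r n))) \<longlonglongrightarrow> 0"
  proof (rule Lim_null_comparison)
    show "\<forall>\<^sub>F n in sequentially. norm (dist (y n) (x (r n))) \<le> dist (x (Suc (r n))) (x (r n))"
      using segment_bound(1)[OF y(2)] by (simp add: dist_norm)
    show "(\<lambda>n. dist (x (Suc (r n))) (x (r n))) \<longlonglongrightarrow> 0"
      using LIMSEQ_subseq_LIMSEQ[OF steps r] by (simp add: o_def)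
  qed
  then have "(\<lambda>n. dist (x ((r \<circ> s) n)) (y (s n))) \<longlonglongrightarrow> 0"
    using LIMSEQ_subseq_LIMSEQ[OF _ s(1), of "\<lambda>n. dist (y n) (x (r n))" 0]
    by (simp add: o_def dist_commute)
  then have "(x \<circ> (r \<circ> s)) \<longlonglongrightarrow> q"
    using Lim_transform[OF s(2), of "x \<circ> (r \<circ> s)"]
    by (simp add: o_def dist_norm tendsto_norm_zero_iff)
  moreover have "strict_mono (r \<circ> s)"
    using r s(1) by (rule strict_mono_o)
  ultimately show ?thesis
    using q by (auto simp: accumulation_points_def)
qed

lemma accumulation_points_bounded:
  fixes x :: "nat \<Rightarrow> 'a::euclidean_space"
  assumes "bounded (x ` {N..})"
  shows "accumulation_points x \<noteq> {}" "compact (accumulation_points x)"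
proof -
  have "seq_compact (closure (x ` {N..}))"
    using assms by (intro compact_imp_seq_compact) (simp add: compact_closure)
  moreover have "\<forall>n. x (n + N) \<in> closure (x ` {N..})"
    using closure_subset[of "x ` {N..}"] by auto
  ultimately obtain l r where "strict_mono r" "((\<lambda>n. x (n + N)) \<circ> r) \<longlonglongrightarrow> l"
    by (rule seq_compactE)
  then have "strict_mono (\<lambda>n. r n + N)" "(x \<circ> (\<lambda>n. r n + N)) \<longlonglongrightarrow> l"
    by (auto simp: strict_mono_def o_def)
  then show "accumulation_points x \<noteq> {}"
    unfolding accumulation_points_def by blast
  have "accumulation_points x \<subseteq> closure (x ` {N..})"
    by (rule accumulation_points_subset_closed[of _ N])
       (use closure_subset[of "x ` {N..}"] in auto)
  then show "compact (accumulation_points x)"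
    using closed_accumulation_points assms bounded_closure bounded_subset compact_eq_bounded_closed
    by blast
qed

text \<open>
  If the accumulation points split into two disjoint compact parts, separate these by disjoint
  open sets. The sequence visits both infinitely often, so it must accumulate on the frontier of
  the first set, which neither part can meet.
\<close>

lemma connected_accumulation_points:
  fixes x :: "nat \<Rightarrow> 'a::euclidean_space"
  assumes steps: "(\<lambda>n. dist (x (Suc n)) (x n)) \<longlonglongrightarrow> 0"
    and bounded: "bounded (x ` {N..})"
  shows "connected (accumulation_points x)"
  unfolding connected_closed_set[OF closed_accumulation_points]
proof (intro notI, elim exE conjE)
  fix A B assume cl: "closed A" "closed B" and ne: "A \<noteq> {}" "B \<noteq> {}"
    and un: "A \<union> B = accumulation_points x" and disj: "A \<inter> B = {}"
  have "compact (A \<union> B)"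
    using un accumulation_points_bounded(2)[OF bounded] by simp
  then have "bounded A"
    using bounded_subset compact_imp_bounded by blast
  then obtain e where A_ball: "A \<subseteq> ball 0 e"
    using bounded_subset_ballD by blast
  obtain V W where VW: "open V" "open W" "A \<subseteq> V" "B \<subseteq> W" "V \<inter> W = {}"
    using separation_normal[OF cl disj] by blast
  define U where "U = V \<inter> ball 0 e"
  have U: "open U" "A \<subseteq> U" "bounded U" "U \<inter> W = {}"
    using VW A_ball by (auto simp: U_def)
  obtain a b where ab: "a \<in> A" "b \<in> B"
    using ne by blast
  then have acc: "a \<in> accumulation_points x" "b \<in> accumulation_points x"
    by (simp_all flip: un)
  have "\<exists>\<^sub>F n in sequentially. x n \<in> U"
    using accumulation_points_frequently_in_open[OF acc(1) U(1)] ab(1) U(2) by blast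
  moreover have "\<exists>\<^sub>F n in sequentially. x n \<in> W"
    using accumulation_points_frequently_in_open[OF acc(2) VW(2)] ab(2) VW(4) by blast
  then have "\<exists>\<^sub>F n in sequentially. x n \<notin> U"
    by (rule frequently_elim1) (use U in blast)
  ultimately have "accumulation_points x \<inter> frontier U \<noteq> {}"
    by (rule accumulation_point_on_frontier[OF steps U(3)])
  then obtain q where q: "q \<in> A \<union> B" "q \<in> closure U" "q \<notin> U"
    unfolding un frontier_def interior_open[OF U(1)] by blast
  have "W \<inter> closure U = {}"
    using open_Int_closure_eq_empty[OF VW(2), of U] U(4) by (simp add: Int_commute)
  then show False
    using q U(2) VW(4) by blast
qed

text \<open>
  A small sphere around an isolated accumulation point carries no accumulation point, so the
  sequence cannot keep crossing it and is eventually caught in the ball.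
\<close>

lemma tendsto_isolated_accumulation_point:
  fixes x :: "nat \<Rightarrow> 'a::euclidean_space"
  assumes steps: "(\<lambda>n. dist (x (Suc n)) (x n)) \<longlonglongrightarrow> 0"
    and p: "p isolated_in accumulation_points x"
  shows "x \<longlonglongrightarrow> p"
proof (rule tendstoI)
  fix e :: real assume "e > 0"
  obtain d where d: "d > 0" "\<And>q. q \<in> accumulation_points x \<Longrightarrow> dist p q < d \<Longrightarrow> q = p"
    using p unfolding isolated_in_dist_Ex_iff by blast
  define r where "r = min d e / 2"
  have r: "0 < r" "r < d" "r < e"
    using d \<open>e > 0\<close> by (auto simp: r_def)
  have "accumulation_points x \<inter> sphere p r = {}"
  proof -
    have "q = p" if "q \<in> accumulation_points x" "q \<in> sphere p r" for q
      using that d(2)[of q] r(2) by simp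
    moreover have "p \<notin> sphere p r"
      using r(1) by simp
    ultimately show ?thesis
      by blast
  qed
  moreover have "\<exists>\<^sub>F n in sequentially. x n \<in> ball p r"
    using p r(1) by (intro accumulation_points_frequently_in_open[of p]) (auto simp: isolated_in_def)
  ultimately have "\<not> (\<exists>\<^sub>F n in sequentially. x n \<notin> ball p r)"
    using accumulation_point_on_frontier[OF steps, of "ball p r"] r(1) by auto
  then have "\<forall>\<^sub>F n in sequentially. x n \<in> ball p r"
    by (simp add: not_frequently)
  then show "\<forall>\<^sub>F n in sequentially. dist (x n) p < e"
    by eventually_elim (use r(3) in \<open>simp add: dist_commute\<close>)
qed

section \<open>Monotone real sequences\<close>

lemma decreasing_at_bot_or_convergent:
  fixes u :: "nat \<Rightarrow> real"
  assumes dec: "\<And>k. k \<ge> N \<Longrightarrow> u (Suc k) \<le> u k"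
  shows "filterlim u at_bot sequentially \<or> convergent u"
proof -
  have anti: "u n \<le> u m" if "N \<le> m" "m \<le> n" for m n
    using that(2)
  proof (induction n rule: dec_induct)
    case (step n)
    then show ?case using dec[of n] that(1) by linarith
  qed simp
  show ?thesis
  proof (cases "\<exists>B. \<forall>k\<ge>N. B \<le> u k")
    case True
    then obtain B where B: "\<And>k. k \<ge> N \<Longrightarrow> B \<le> u k" by blast
    have "decseq (\<lambda>k. u (k + N))"
      using anti by (simp add: decseq_def)
    moreover have "\<forall>k. B \<le> u (k + N)"
      by (simp add: B)
    ultimately obtain l where "(\<lambda>k. u (k + N)) \<longlonglongrightarrow> l"
      by (rule decseq_convergent)
    then have "convergent (\<lambda>k. u (k + N))"
      by (rule convergentI)
    then show ?thesis
      using convergent_ignore_initial_segment by blast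
  next
    case False
    have "\<forall>\<^sub>F k in sequentially. u k \<le> Z" for Z
    proof -
      obtain m where "m \<ge> N" "u m < Z"
        using False not_le by blast
      then have "\<forall>k\<ge>m. u k \<le> Z"
        using anti[of m] by (meson less_imp_le order_trans)
      then show ?thesis
        by (auto simp: eventually_sequentially)
    qed
    then show ?thesis
      by (simp add: filterlim_at_bot)
  qed
qed

text \<open>
  This serves both for \<open>C\<close>, which a failure multiplies by \<open>\<eta>\<close>, and for the reciprocal of the
  linesearch threshold, which a failure multiplies by \<open>inverse \<gamma>\<close>.
\<close>

lemma at_top_if_frequently_multiplied:
  fixes a :: "nat \<Rightarrow> real"
  assumes pos: "a N > 0" and mono: "\<And>k. k \<ge> N \<Longrightarrow> a k \<le> a (Suc k)" and "c > 1"
    and freq: "\<exists>\<^sub>F k in sequentially. c * a k \<le> a (Suc k)"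
  shows "filterlim a at_top sequentially"
proof -
  have mono': "a m \<le> a n" if "N \<le> m" "m \<le> n" for m n
    using that(2)
  proof (induction n rule: dec_induct)
    case (step n)
    then show ?case using mono[of n] that(1) by linarith
  qed simp
  have growth: "\<exists>M\<ge>N. c ^ j * a N \<le> a M" for j
  proof (induction j)
    case (Suc j)
    then obtain M where M: "M \<ge> N" "c ^ j * a N \<le> a M" by blast
    obtain k where k: "k \<ge> M" "c * a k \<le> a (Suc k)"
      using freq by (auto simp: frequently_sequentially)
    have "c ^ Suc j * a N \<le> c * a M"
      using M(2) \<open>c > 1\<close> by simp
    also have "\<dots> \<le> c * a k"
      using mono'[of M k] M(1) k(1) \<open>c > 1\<close> by simp
    finally show ?case
      using k M(1) by (intro exI[of _ "Suc k"]) auto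
  qed auto
  show ?thesis
    unfolding filterlim_at_top
  proof
    fix Z
    obtain j where "Z / a N < c ^ j"
      using real_arch_pow[OF \<open>c > 1\<close>] by blast
    then have "Z \<le> c ^ j * a N"
      using pos by (simp add: field_simps)
    moreover obtain M where "M \<ge> N" "c ^ j * a N \<le> a M"
      using growth by blast
    ultimately have "\<forall>k\<ge>M. Z \<le> a k"
      using mono'[of M] by (meson order_trans)
    then show "\<forall>\<^sub>F k in sequentially. Z \<le> a k"
      by (auto simp: eventually_sequentially)
  qed
qed

section \<open>Sufficient decrease along approximate gradients\<close>

lemma C1_smooth_has_derivative:
  assumes "C1_smooth f"
  shows "(f has_derivative (\<lambda>h. inner h (gradient f x))) (at x)"
  using assms GDERIV_gradient unfolding C1_smooth_def gderiv_def by blast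

text \<open>
  The mean value theorem replaces the usual integral remainder; the price is the constant \<open>L\<close>
  in place of \<open>L / 2\<close>, which is harmless because only the existence of an admissible stepsize
  matters.
\<close>

lemma descent_lemma:
  assumes f: "C1_smooth f" and lip: "L-lipschitz_on S (gradient f)"
    and seg: "closed_segment y (y + h) \<subseteq> S"
  shows "f (y + h) \<le> f y + inner (gradient f y) h + L * (norm h)\<^sup>2"
proof -
  have "\<exists>s\<in>{0<..<1}. f (y + 1 *\<^sub>R h) - f (y + 0 *\<^sub>R h) =
      (\<lambda>t. inner (t *\<^sub>R h) (gradient f (y + s *\<^sub>R h))) (1 - 0)"
  proof (rule mvt_simple)
    fix s :: real assume "0 \<le> s" "s \<le> 1"
    have "((\<lambda>s. y + s *\<^sub>R h) has_derivative (\<lambda>t. t *\<^sub>R h)) (at s within {0..1})"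
      by (auto intro!: derivative_eq_intros)
    from has_derivative_compose[OF this C1_smooth_has_derivative[OF f]]
    show "((\<lambda>s. f (y + s *\<^sub>R h)) has_derivative
        (\<lambda>t. inner (t *\<^sub>R h) (gradient f (y + s *\<^sub>R h)))) (at s within {0..1})" .
  qed simp
  then obtain s where s: "0 < s" "s < 1"
    and eq: "f (y + h) - f y = inner h (gradient f (y + s *\<^sub>R h))"
    by auto
  have "y + s *\<^sub>R h \<in> closed_segment y (y + h)"
    using s unfolding closed_segment_def by (auto simp: algebra_simps intro!: exI[of _ s])
  then have in_S: "y \<in> S" "y + s *\<^sub>R h \<in> S"
    using seg by auto
  have "f (y + h) - f y - inner (gradient f y) h =
      inner h (gradient f (y + s *\<^sub>R h) - gradient f y)"
    by (simp add: eq inner_diff_right inner_commute)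
  also have "\<dots> \<le> norm h * norm (gradient f (y + s *\<^sub>R h) - gradient f y)"
    by (rule norm_cauchy_schwarz)
  also have "\<dots> \<le> norm h * (L * norm (s *\<^sub>R h))"
    using lipschitz_onD[OF lip in_S(2,1)] by (intro mult_left_mono) (auto simp: dist_norm)
  also have "\<dots> \<le> norm h * (L * norm h)"
    using s lipschitz_on_nonneg[OF lip]
    by (intro mult_left_mono) (auto intro: mult_left_le_one_le)
  finally show ?thesis
    by (simp add: power2_eq_square algebra_simps)
qed

text \<open>
  An error of at most half the length of \<open>v\<close> keeps the rate of decrease of \<open>f\<close> along \<open>- v\<close> at
  least half of the square of \<open>norm v\<close>, and \<open>\<beta> < 1/2\<close> leaves room for the quadratic remainder.
\<close>

lemma sufficient_decrease:
  assumes f: "C1_smooth f" and lip: "L-lipschitz_on S (gradient f)"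
    and seg: "closed_segment y (y - t *\<^sub>R v) \<subseteq> S"
    and err: "norm (v - gradient f y) \<le> norm v / 2"
    and t: "t \<ge> 0" "L * t \<le> 1 / 2 - \<beta>"
  shows "f (y - t *\<^sub>R v) \<le> f y - \<beta> * t * (norm v)\<^sup>2"
proof -
  have "inner (v - gradient f y) v \<le> norm (v - gradient f y) * norm v"
    by (rule norm_cauchy_schwarz)
  also have "\<dots> \<le> (norm v)\<^sup>2 / 2"
    using mult_right_mono[OF err, of "norm v"] by (simp add: power2_eq_square)
  finally have slope: "(norm v)\<^sup>2 / 2 \<le> inner (gradient f y) v"
    by (simp add: inner_diff_left dot_square_norm)
  have "f (y - t *\<^sub>R v) \<le> f y - t * inner (gradient f y) v + L * t * t * (norm v)\<^sup>2"
    using descent_lemma[OF f lip, of y "- (t *\<^sub>R v)"] seg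
    by (simp add: power_mult_distrib power2_eq_square algebra_simps)
  also have "\<dots> \<le> f y - t * ((norm v)\<^sup>2 / 2) + (1 / 2 - \<beta>) * t * (norm v)\<^sup>2"
    using mult_left_mono[OF slope t(1)] mult_right_mono[OF t(2), of "t * (norm v)\<^sup>2"] t(1)
    by (simp add: algebra_simps)
  also have "\<dots> = f y - \<beta> * t * (norm v)\<^sup>2"
    by (simp add: algebra_simps)
  finally show ?thesis .
qed

section \<open>Runs of the method\<close>

context DFB
begin

lemma backtracking_le: "0 \<le> t \<Longrightarrow> \<gamma> * t \<le> t"
  using linesearch(3,4) by (simp add: mult_left_le_one_le)

lemma linesearch_range:
  assumes "k \<ge> 1"
  shows "0 < ls k" "ls k \<le> \<tau>max"
proof -
  have "0 < ls k \<and> ls k \<le> \<tau>max"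
  proof (rule while_option_rule[OF _ step2[OF assms]])
    show "0 < \<gamma> * t \<and> \<gamma> * t \<le> \<tau>max" if "0 < t \<and> t \<le> \<tau>max" for t
      using that linesearch(3) order_trans[OF backtracking_le[of t], of \<tau>max] by simp
  qed (use linesearch in auto)
  then show "0 < ls k" "ls k \<le> \<tau>max" by auto
qed

lemma linesearch_decrease:
  assumes "k \<ge> 1" "ls k \<ge> tmin k"
  shows "f (x k - ls k *\<^sub>R g k) \<le> f (x k) - \<beta> * ls k * (norm (g k))\<^sup>2"
  using while_option_stop[OF step2[OF assms(1)]] assms(2) by auto

text \<open>
  A trial stepsize is shrunk only if it is rejected, hence only if it exceeds \<open>s\<close>; shrinking then
  leaves more than \<open>\<gamma> * s\<close>, which makes \<open>\<gamma> * s \<le> t\<close> a loop invariant.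
\<close>

lemma linesearch_lower_bound:
  assumes "k \<ge> 1" "s \<le> \<tau>max" "s > 0"
    and ok: "\<And>t. 0 < t \<Longrightarrow> t \<le> s \<Longrightarrow> f (x k - t *\<^sub>R g k) \<le> f (x k) - \<beta> * t * (norm (g k))\<^sup>2"
  shows "\<gamma> * s \<le> ls k"
proof -
  have "0 < ls k \<and> \<gamma> * s \<le> ls k"
  proof (rule while_option_rule[OF _ step2[OF assms(1)]])
    show "0 < \<tau>max \<and> \<gamma> * s \<le> \<tau>max"
      using assms(2,3) linesearch(5) order_trans[OF backtracking_le[of s], of \<tau>max] by simp
    show "0 < \<gamma> * t \<and> \<gamma> * s \<le> \<gamma> * t"
      if "0 < t \<and> \<gamma> * s \<le> t"
        "f (x k) - \<beta> * t * (norm (g k))\<^sup>2 < f (x k - t *\<^sub>R g k) \<and> tmin k \<le> t" for t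
      using that ok[of t] linesearch(3) by (cases "t \<le> s") auto
  qed
  then show ?thesis by simp
qed

lemma stepsize_range:
  assumes "k \<ge> 1"
  shows "0 \<le> \<tau> k" "\<tau> k \<le> \<tau>max"
  using step3_success[OF assms] step3_failure[OF assms] linesearch_range[OF assms] linesearch(5)
  by (cases "tmin k \<le> ls k"; simp)+

lemma decrease:
  assumes "k \<ge> 1"
  shows "\<beta> * \<tau> k * (norm (g k))\<^sup>2 \<le> f (x k) - f (x (Suc k))"
  using step3_success[OF assms] step3_failure[OF assms] linesearch_decrease[OF assms]
    step4[OF assms]
  by (cases "tmin k \<le> ls k") auto

lemma objective_decreasing: "k \<ge> 1 \<Longrightarrow> f (x (Suc k)) \<le> f (x k)"
  using decrease[of k] stepsize_range(1)[of k] linesearch(1)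
  by (smt (verit) mult_nonneg_nonneg zero_le_power2)

lemma radius_range:
  assumes "k \<ge> 1"
  shows "0 < \<delta> k" "\<delta> k \<le> \<delta> 1"
proof -
  have "0 < \<delta> k \<and> \<delta> k \<le> \<delta> 1"
    using assms
  proof (induction k rule: dec_induct)
    case (step m)
    have "0 < \<theta> ^ i m" "\<theta> ^ i m \<le> 1"
      using factors by (auto intro: power_le_one)
    then have "0 < \<delta> (Suc m)" "\<delta> (Suc m) \<le> \<delta> m"
      using step step1_delta[of m] by (simp_all add: mult_left_le_one_le)
    then show ?case
      using step.IH by linarith
  qed (use init in auto)
  then show "0 < \<delta> k" "\<delta> k \<le> \<delta> 1" by auto
qed

lemma parameters_pos:
  assumes "k \<ge> 1"
  shows "0 < C k" "0 < tmin k"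
proof -
  have "0 < C k \<and> 0 < tmin k"
    using assms
  proof (induction k rule: dec_induct)
    case (step m)
    then show ?case
      using step3_success[of m] step3_failure[of m] factors linesearch
      by (cases "tmin m \<le> ls m") auto
  qed (use init in auto)
  then show "0 < C k" "0 < tmin k" by auto
qed

lemma approximation_error:
  assumes "bounded S"
  obtains K where "K > 0"
    "\<And>k. k \<ge> 1 \<Longrightarrow> x k \<in> S \<Longrightarrow> norm (g k - gradient f (x k)) \<le> K * min (\<delta> (Suc k)) (\<nu> k)"
proof -
  obtain K where K: "K > 0"
    "\<And>y d. y \<in> S \<Longrightarrow> 0 < d \<Longrightarrow> d \<le> \<delta> 1 \<Longrightarrow> norm (G y d - gradient f y) \<le> K * d"
    using approx assms init(1) unfolding local_approximation_def
    by (metis greaterThanAtMost_iff)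
  have "norm (g k - gradient f (x k)) \<le> K * min (\<delta> (Suc k)) (\<nu> k)" if "k \<ge> 1" "x k \<in> S" for k
    using K(2)[OF that(2), of "min (\<delta> (Suc k)) (\<nu> k)"] nu_pos[OF that(1)]
      radius_range[of "Suc k"] step1_g[OF that(1)] step1_delta[OF that(1)] by auto
  with K(1) show thesis using that by blast
qed

text \<open>
  The squared step \<open>\<tau> k * (\<tau> k * (norm (g k))\<^sup>2)\<close> is at most \<open>\<tau>max / \<beta>\<close> times the decrease of
  the objective, and these decreases vanish when the objective converges.
\<close>

lemma steps_tendsto_0:
  assumes "convergent (\<lambda>k. f (x k))"
  shows "(\<lambda>k. \<tau> k * (norm (g k))\<^sup>2) \<longlonglongrightarrow> 0" "(\<lambda>k. dist (x (Suc k)) (x k)) \<longlonglongrightarrow> 0"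
proof -
  obtain l where l: "(\<lambda>k. f (x k)) \<longlonglongrightarrow> l"
    using assms convergent_def by blast
  have "(\<lambda>k. (f (x k) - f (x (Suc k))) / \<beta>) \<longlonglongrightarrow> (l - l) / \<beta>"
    using linesearch(1) by (intro tendsto_intros l LIMSEQ_Suc) auto
  then have lim: "(\<lambda>k. (f (x k) - f (x (Suc k))) / \<beta>) \<longlonglongrightarrow> 0"
    by simp
  have "\<forall>\<^sub>F k in sequentially. norm (\<tau> k * (norm (g k))\<^sup>2) \<le> (f (x k) - f (x (Suc k))) / \<beta>"
    using eventually_ge_at_top[of 1]
  proof eventually_elim
    case (elim k)
    then show ?case
      using decrease[OF elim] stepsize_range(1)[OF elim] linesearch(1)
      by (simp add: pos_le_divide_eq mult_ac)
  qed
  then show lim_g: "(\<lambda>k. \<tau> k * (norm (g k))\<^sup>2) \<longlonglongrightarrow> 0"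
    by (rule Lim_null_comparison[OF _ lim])
  have "\<forall>\<^sub>F k in sequentially. norm ((dist (x (Suc k)) (x k))\<^sup>2) \<le> \<tau>max * (\<tau> k * (norm (g k))\<^sup>2)"
    using eventually_ge_at_top[of 1]
  proof eventually_elim
    case (elim k)
    have "norm ((dist (x (Suc k)) (x k))\<^sup>2) = \<tau> k * (\<tau> k * (norm (g k))\<^sup>2)"
      using step4[OF elim] by (simp add: dist_norm power2_eq_square)
    also have "\<dots> \<le> \<tau>max * (\<tau> k * (norm (g k))\<^sup>2)"
      using stepsize_range[OF elim] by (intro mult_right_mono) auto
    finally show ?case .
  qed
  moreover have "(\<lambda>k. \<tau>max * (\<tau> k * (norm (g k))\<^sup>2)) \<longlonglongrightarrow> 0"
    using tendsto_mult_left[OF lim_g, of \<tau>max] by simp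
  ultimately have "(\<lambda>k. (dist (x (Suc k)) (x k))\<^sup>2) \<longlonglongrightarrow> 0"
    by (rule Lim_null_comparison)
  then show "(\<lambda>k. dist (x (Suc k)) (x k)) \<longlonglongrightarrow> 0"
    by simp
qed

text \<open>
  A run with infinitely many rejected linesearches adapts its parameters without bound: the error
  constant eventually exceeds any local one, and the threshold falls below any stepsize.
\<close>

lemma parameters_if_frequent_failure:
  assumes "\<exists>\<^sub>F k in sequentially. ls k < tmin k"
  shows "filterlim C at_top sequentially" "tmin \<longlonglongrightarrow> 0"
proof -
  have freq: "\<exists>\<^sub>F k in sequentially. ls k < tmin k \<and> k \<ge> 1"
    using frequently_eventually_frequently[OF assms eventually_ge_at_top[of 1]]
    by simp
  show "filterlim C at_top sequentially"
  proof (rule at_top_if_frequently_multiplied[of C 1 \<eta>])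
    show "C k \<le> C (Suc k)" if "k \<ge> 1" for k
      using step3_success[OF that] step3_failure[OF that] factors parameters_pos(1)[OF that]
      by (cases "tmin k \<le> ls k") auto
    show "\<exists>\<^sub>F k in sequentially. \<eta> * C k \<le> C (Suc k)"
      using freq by (rule frequently_elim1) (use step3_failure in auto)
  qed (use init factors in auto)
  have "filterlim (\<lambda>k. inverse (tmin k)) at_top sequentially"
  proof (rule at_top_if_frequently_multiplied[of _ 1 "inverse \<gamma>"])
    show "inverse (tmin k) \<le> inverse (tmin (Suc k))" if "k \<ge> 1" for k
      using step3_success[OF that] step3_failure[OF that] linesearch parameters_pos(2)[OF that]
        backtracking_le[of "tmin k"]
      by (cases "tmin k \<le> ls k") (auto simp: one_le_inverse)
    show "\<exists>\<^sub>F k in sequentially. inverse \<gamma> * inverse (tmin k) \<le> inverse (tmin (Suc k))"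
      using freq by (rule frequently_elim1) (use step3_failure in auto)
  qed (use init linesearch in \<open>auto simp: one_less_inverse\<close>)
  then have "(\<lambda>k. inverse (inverse (tmin k))) \<longlonglongrightarrow> 0"
    by (rule tendsto_inverse_0_at_top)
  then show "tmin \<longlonglongrightarrow> 0" by simp
qed

text \<open>
  If the linesearch fails only finitely often, the threshold freezes and bounds the stepsizes from
  below. Otherwise \<open>C\<close> eventually dominates the local approximation constant, and the acceptance
  test of the radius selection, with \<open>\<mu> > 2\<close>, turns this into a relative error below one half.
  Then every stepsize up to a fixed \<open>s\<close> gives sufficient decrease, and the threshold eventually
  lies below \<open>\<gamma> * s\<close>.
\<close>

lemma stepsize_locally_bounded_below:
  assumes f: "C1_smooth f" and lip: "locally_Lipschitz (gradient f)"
  obtains t where "t > 0" "\<forall>\<^sub>F k in sequentially. x k \<in> cball p 1 \<longrightarrow> t \<le> \<tau> k"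
proof (cases "\<exists>\<^sub>F k in sequentially. ls k < tmin k")
  case False
  then obtain N where N: "\<And>k. k \<ge> N \<Longrightarrow> tmin k \<le> ls k"
    by (auto simp: frequently_def eventually_sequentially not_less)
  define M where "M = max N 1"
  have M: "M \<ge> 1" "\<And>k. k \<ge> M \<Longrightarrow> tmin k \<le> ls k"
    using N by (auto simp: M_def)
  have "tmin k = tmin M" if "k \<ge> M" for k
    using that
  proof (induction k rule: dec_induct)
    case (step m)
    then show ?case using step3_success[of m] M(1) M(2)[of m] by simp
  qed simp
  then have "\<forall>k\<ge>M. tmin M \<le> \<tau> k"
    using M order_trans step3_success by (metis (no_types))
  then have "\<forall>k\<ge>M. x k \<in> cball p 1 \<longrightarrow> tmin M \<le> \<tau> k"
    by blast
  then show thesis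
    using that[OF parameters_pos(2)[OF M(1)]] by (auto simp: eventually_sequentially)
next
  case True
  note limits = parameters_if_frequent_failure[OF True]
  obtain K where "K > 0" and err: "\<And>k. k \<ge> 1 \<Longrightarrow> x k \<in> cball p 1 \<Longrightarrow>
      norm (g k - gradient f (x k)) \<le> K * min (\<delta> (Suc k)) (\<nu> k)"
    using approximation_error[OF bounded_cball[of p 1]] by blast
  have "compact (gradient f ` cball p 1)"
    using f by (intro compact_continuous_image)
      (auto simp: C1_smooth_def intro: continuous_on_subset)
  then obtain B where B: "\<And>y. y \<in> cball p 1 \<Longrightarrow> norm (gradient f y) \<le> B"
    using compact_imp_bounded bounded_iff by (metis image_eqI)
  obtain L0 where "L0-lipschitz_on (cball p 2) (gradient f)"
    using lip unfolding locally_Lipschitz_def by (meson compact_cball)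
  (* a positive Lipschitz constant, so that it can be divided by *)
  then have L: "(max L0 1)-lipschitz_on (cball p 2) (gradient f)"
    by (rule lipschitz_on_mono) auto
  define R where "R = B + K * \<delta> 1"
  have "norm (gradient f p) \<le> B" by (rule B) simp
  then have "B \<ge> 0" using norm_ge_zero order_trans by blast
  then have "R > 0" using \<open>K > 0\<close> init(1) by (simp add: R_def add_nonneg_pos)
  (* R bounds the directions, so steps up to 1 / R end within distance 1 of x k, hence in the ball of
     radius 2 where the gradient is Lipschitz; the last bound is the one of sufficient_decrease *)
  define s where "s = min \<tau>max (min (1 / R) ((1 / 2 - \<beta>) / max L0 1))"
  have s: "s > 0" "s \<le> \<tau>max" "s \<le> 1 / R" "s \<le> (1 / 2 - \<beta>) / max L0 1"
    using \<open>R > 0\<close> linesearch by (auto simp: s_def)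
  have "\<gamma> * s > 0" using s(1) linesearch(3) by simp
  have "\<forall>\<^sub>F k in sequentially. K \<le> C k"
    using limits(1) by (auto simp: filterlim_at_top)
  moreover have "\<forall>\<^sub>F k in sequentially. tmin k < \<gamma> * s"
    using limits(2) \<open>\<gamma> * s > 0\<close> by (rule order_tendstoD)
  ultimately have "\<forall>\<^sub>F k in sequentially. x k \<in> cball p 1 \<longrightarrow> \<gamma> * s \<le> \<tau> k"
    using eventually_ge_at_top[of 1]
  proof eventually_elim
    case (elim k)
    show ?case
    proof
      assume xk: "x k \<in> cball p 1"
      have \<delta>: "0 < \<delta> (Suc k)" "\<delta> (Suc k) \<le> \<delta> 1"
        using radius_range[of "Suc k"] by auto
      have e: "norm (g k - gradient f (x k)) \<le> K * \<delta> (Suc k)"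
        using err[OF elim(3) xk] \<open>K > 0\<close> by (smt (verit) min.cobounded1 mult_left_mono)
      also have "\<dots> \<le> C k * \<delta> (Suc k)"
        using elim(1) \<delta>(1) by (intro mult_right_mono) auto
      also have "\<dots> \<le> norm (g k) / 2"
      proof -
        have "2 * (C k * \<delta> (Suc k)) \<le> \<mu> * (C k * \<delta> (Suc k))"
          using factors(3) parameters_pos(1)[OF elim(3)] \<delta>(1) by (intro mult_right_mono) auto
        also have "\<dots> \<le> norm (g k)"
          using step1_accept[OF elim(3)] step1_delta[OF elim(3)] by (simp add: mult.assoc)
        finally show ?thesis by simp
      qed
      finally have half: "norm (g k - gradient f (x k)) \<le> norm (g k) / 2" .
      have "norm (g k) \<le> norm (gradient f (x k)) + norm (g k - gradient f (x k))"
        by (rule norm_triangle_sub)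
      also have "\<dots> \<le> R"
        unfolding R_def using B[OF xk] e mult_left_mono[OF \<delta>(2), of K] \<open>K > 0\<close> by linarith
      finally have gR: "norm (g k) \<le> R" .
      have "\<gamma> * s \<le> ls k"
      proof (rule linesearch_lower_bound[OF elim(3) s(2,1)])
        fix t assume t: "0 < t" "t \<le> s"
        have "t * norm (g k) \<le> 1 / R * R"
          using t s(3) gR \<open>R > 0\<close> by (intro mult_mono) auto
        then have "dist (x k) (x k - t *\<^sub>R g k) \<le> 1"
          using t \<open>R > 0\<close> by (simp add: dist_norm)
        then have "x k - t *\<^sub>R g k \<in> cball p 2"
          using xk dist_triangle[of p "x k - t *\<^sub>R g k" "x k"] by simp
        then have "closed_segment (x k) (x k - t *\<^sub>R g k) \<subseteq> cball p 2"
          using xk by (intro closed_segment_subset) auto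
        moreover have "max L0 1 * t \<le> 1 / 2 - \<beta>"
          using order_trans[OF t(2) s(4)] by (simp add: pos_le_divide_eq mult.commute)
        ultimately show "f (x k - t *\<^sub>R g k) \<le> f (x k) - \<beta> * t * (norm (g k))\<^sup>2"
          using t(1) by (intro sufficient_decrease[OF f L _ half]) auto
      qed
      then show "\<gamma> * s \<le> \<tau> k"
        using step3_success[OF elim(3)] elim(2) by auto
    qed
  qed
  then show thesis using that \<open>\<gamma> * s > 0\<close> by blast
qed

text \<open>
  Along a subsequence converging to \<open>p\<close> the stepsizes stay above some \<open>t > 0\<close>, so the vanishing
  of \<open>\<tau> k * (norm (g k))\<^sup>2\<close> forces \<open>g k\<close> to vanish; the error bound \<open>K * \<nu> k\<close> then transfers
  this to the gradient.
\<close>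

lemma accumulation_point_stationary:
  assumes f: "C1_smooth f" and lip: "locally_Lipschitz (gradient f)"
    and conv: "convergent (\<lambda>k. f (x k))" and p: "p \<in> accumulation_points x"
  shows "stationary_point f p"
proof -
  obtain r where r: "strict_mono r" and lim: "(x \<circ> r) \<longlonglongrightarrow> p"
    using p by (auto simp: accumulation_points_def)
  have sub: "filterlim r sequentially sequentially"
    using r by (rule filterlim_subseq)
  have near: "\<forall>\<^sub>F n in sequentially. x (r n) \<in> cball p 1"
    using tendstoD[OF lim zero_less_one] by eventually_elim (simp add: dist_commute)
  have ge1: "\<forall>\<^sub>F n in sequentially. r n \<ge> 1"
    using eventually_compose_filterlim[OF eventually_ge_at_top[of 1] sub] .
  obtain t where t: "t > 0" "\<forall>\<^sub>F k in sequentially. x k \<in> cball p 1 \<longrightarrow> t \<le> \<tau> k"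
    using stepsize_locally_bounded_below[OF f lip] by blast
  have "\<forall>\<^sub>F n in sequentially.
      norm ((norm (g (r n)))\<^sup>2) \<le> \<tau> (r n) * (norm (g (r n)))\<^sup>2 / t"
    using near eventually_compose_filterlim[OF t(2) sub]
  proof eventually_elim
    case (elim n)
    then show ?case
      using t(1) mult_right_mono[of t "\<tau> (r n)" "(norm (g (r n)))\<^sup>2"]
      by (simp add: pos_le_divide_eq mult.commute)
  qed
  moreover have "(\<lambda>n. \<tau> (r n) * (norm (g (r n)))\<^sup>2 / t) \<longlonglongrightarrow> 0"
    using tendsto_divide_zero[OF filterlim_compose[OF steps_tendsto_0(1)[OF conv] sub]] .
  ultimately have "(\<lambda>n. (norm (g (r n)))\<^sup>2) \<longlonglongrightarrow> 0"
    by (rule Lim_null_comparison)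
  then have g0: "(\<lambda>n. g (r n)) \<longlonglongrightarrow> 0"
    by (simp add: tendsto_norm_zero_iff)
  obtain K where K: "K > 0" "\<And>k. k \<ge> 1 \<Longrightarrow> x k \<in> cball p 1 \<Longrightarrow>
      norm (g k - gradient f (x k)) \<le> K * min (\<delta> (Suc k)) (\<nu> k)"
    using approximation_error[OF bounded_cball[of p 1]] by blast
  have "\<forall>\<^sub>F n in sequentially. norm (g (r n) - gradient f (x (r n))) \<le> K * \<nu> (r n)"
    using near ge1
  proof eventually_elim
    case (elim n)
    then show ?case
      using K(2)[OF elim(2,1)] K(1) by (smt (verit) min.cobounded2 mult_left_mono)
  qed
  moreover have "(\<lambda>n. K * \<nu> (r n)) \<longlonglongrightarrow> 0"
    using tendsto_mult_right_zero[OF filterlim_compose[OF nu_tendsto sub]] .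
  ultimately have "(\<lambda>n. g (r n) - gradient f (x (r n))) \<longlonglongrightarrow> 0"
    by (rule Lim_null_comparison)
  from tendsto_diff[OF g0 this] have "(\<lambda>n. gradient f (x (r n))) \<longlonglongrightarrow> 0"
    by simp
  moreover have "(\<lambda>n. gradient f (x (r n))) \<longlonglongrightarrow> gradient f p"
    using f lim unfolding C1_smooth_def
    by (auto simp: o_def continuous_on_eq_continuous_at intro: isCont_tendsto_compose)
  ultimately show ?thesis
    unfolding stationary_point_def using LIMSEQ_unique by blast
qed

end

section \<open>Global convergence\<close>

theorem theorem5p4:
  fixes f :: "real ^ 'n \<Rightarrow> real"
    and G :: "real ^ 'n \<Rightarrow> real \<Rightarrow> real ^ 'n"
    and \<theta> \<mu> \<eta> \<beta> \<gamma> \<tau>max :: real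
    and \<nu> :: "nat \<Rightarrow> real"
    and x g :: "nat \<Rightarrow> real ^ 'n"
    and i :: "nat \<Rightarrow> nat"
    and \<delta> C tmin ls \<tau> :: "nat \<Rightarrow> real"
  assumes "C1_smooth f"
    and "locally_Lipschitz (gradient f)"
    and "DFB f G \<theta> \<mu> \<eta> \<beta> \<gamma> \<tau>max \<nu> x g i \<delta> C tmin ls \<tau>"
    and "\<forall>k\<ge>1. gradient f (x k) \<noteq> 0"
  shows "filterlim (\<lambda>k. f (x k)) at_bot sequentially \<or>
    ((\<forall>p\<in>accumulation_points x. stationary_point f p) \<and>
     (bounded (x ` {1..}) \<longrightarrow>
        accumulation_points x \<noteq> {} \<and> compact (accumulation_points x) \<and>
        connected (accumulation_points x)) \<and>
     (\<forall>p. p isolated_in accumulation_points x \<longrightarrow> x \<longlonglongrightarrow> p))"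
proof -
  interpret DFB f G \<theta> \<mu> \<eta> \<beta> \<gamma> \<tau>max \<nu> x g i \<delta> C tmin ls \<tau>
    by fact
  consider "filterlim (\<lambda>k. f (x k)) at_bot sequentially" | "convergent (\<lambda>k. f (x k))"
    using decreasing_at_bot_or_convergent[of 1 "\<lambda>k. f (x k)"] objective_decreasing by blast
  then show ?thesis
  proof cases
    case 2
    note steps = steps_tendsto_0(2)[OF 2]
    show ?thesis
      using accumulation_point_stationary[OF assms(1,2) 2] accumulation_points_bounded[of x 1]
        connected_accumulation_points[OF steps, of 1] tendsto_isolated_accumulation_point[OF steps]
      by blast
  qed simp
qed

end
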